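(* Let $V$ be a finite-dimensional vector space over a field $\mathbb K$, $e\in\mathfrak{gl}(V)$ a nilpotent element with $k$ Jordan blocks, and $\mathfrak z(e)$ its centraliser in $\mathfrak{gl}(V)$. Let $w_1,\dots,w_k$ be generators of the Jordan blocks, $d_i+1$ the dimension of the $i$-th block, and $c_i^{j,s}(\varphi)$ the coefficients of $\varphi\in\mathfrak z(e)$ as defined in the context. Let $a_1,\dots,a_k\in\mathbb K$ be non-zero pairwise distinct, and define $\alpha\in\mathfrak z(e)^*$ by $$\alpha(\varphi)=\sum_{i=1}^k a_i\, c_i^{i,d_i}(\varphi).$$ Then the stabiliser $\mathfrak z(e)_\alpha$ consists of all elements of $\mathfrak z(e)$ preserving the space of each Jordan block; i.e., $\mathfrak z(e)_\alpha$ is the linear span of the vectors $\xi_i^{i,s}$, $1\le i\le k$, $0\le s\le d_i$.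
   Context: The vectors $e^{s}w_i$ with $1\le i\le k$, $0\le s\le d_i$ form a basis of $V$, and $e^{d_i+1}w_i=0$; the space of the $i$-th Jordan block is the span of $e^sw_i$, $0\le s\le d_i$. An element $\varphi\in\mathfrak z(e)$ is determined by its values $\varphi(w_i)=\sum_{j,s}c_i^{j,s}(\varphi)\,e^sw_j$, which define the coefficients $c_i^{j,s}(\varphi)\in\mathbb K$. The centraliser $\mathfrak z(e)$ has the basis $\{\xi_i^{j,s}\}$, where $\xi_i^{j,s}\in\mathfrak z(e)$ is given by $\xi_i^{j,s}(w_i)=e^sw_j$ and $\xi_i^{j,s}(w_t)=0$ for $t\ne i$, with $\max(0,d_j-d_i)\le s\le d_j$. The stabiliser is $\mathfrak z(e)_\alpha=\{\xi\in\mathfrak z(e):\alpha([\xi,\mathfrak z(e)])=0\}$. *)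

theory Defs
  imports HOL.Vector_Spaces "HOL-Library.Function_Algebras"
begin

(* The pointwise zero, sum and difference of endomorphisms come from Function_Algebras; the
   pointwise product defined there is never used: products of operators are compositions and
   powers of operators are iterates (e ^^ s). *)

context vector_space
begin

definition gl :: "('b \<Rightarrow> 'b) set"
  where "gl = {f. Vector_Spaces.linear scale scale f}"

definition op_scale :: "'a \<Rightarrow> ('b \<Rightarrow> 'b) \<Rightarrow> 'b \<Rightarrow> 'b"
  where "op_scale c f = (\<lambda>v. c *s f v)"

definition op_span :: "('b \<Rightarrow> 'b) set \<Rightarrow> ('b \<Rightarrow> 'b) set"
  where "op_span = module.span op_scale"

definition lie_bracket :: "('b \<Rightarrow> 'b) \<Rightarrow> ('b \<Rightarrow> 'b) \<Rightarrow> 'b \<Rightarrow> 'b"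
  where "lie_bracket f g = (f \<circ> g) - (g \<circ> f)"

definition nilpotent :: "('b \<Rightarrow> 'b) \<Rightarrow> bool"
  where "nilpotent f \<longleftrightarrow> (\<exists>n. f ^^ n = 0)"

definition centraliser :: "('b \<Rightarrow> 'b) \<Rightarrow> ('b \<Rightarrow> 'b) set"
  where "centraliser e = {\<phi> \<in> gl. lie_bracket \<phi> e = 0}"

(* A functional on the centraliser is a function on all maps of which only the values on the
   centraliser matter; the centraliser is closed under the bracket. *)
definition stabiliser :: "('b \<Rightarrow> 'b) \<Rightarrow> (('b \<Rightarrow> 'b) \<Rightarrow> 'a) \<Rightarrow> ('b \<Rightarrow> 'b) set"
  where "stabiliser e \<alpha> = {\<xi> \<in> centraliser e. \<forall>\<eta> \<in> centraliser e. \<alpha> (lie_bracket \<xi> \<eta>) = 0}"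

definition jordan_index :: "nat \<Rightarrow> (nat \<Rightarrow> nat) \<Rightarrow> (nat \<times> nat) set"
  where "jordan_index k d = (SIGMA i:{1..k}. {0..d i})"

definition jordan_basis :: "('b \<Rightarrow> 'b) \<Rightarrow> nat \<Rightarrow> (nat \<Rightarrow> nat) \<Rightarrow> (nat \<Rightarrow> 'b) \<Rightarrow> 'b set"
  where "jordan_basis e k d w = (\<lambda>(i, s). (e ^^ s) (w i)) ` jordan_index k d"

(* Injectivity of the indexing is needed because independence is a property of the set of
   vectors, not of the family. *)
definition jordan_generators :: "('b \<Rightarrow> 'b) \<Rightarrow> nat \<Rightarrow> (nat \<Rightarrow> nat) \<Rightarrow> (nat \<Rightarrow> 'b) \<Rightarrow> bool"
  where "jordan_generators e k d w \<longleftrightarrow>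
    inj_on (\<lambda>(i, s). (e ^^ s) (w i)) (jordan_index k d) \<and>
    independent (jordan_basis e k d w) \<and> span (jordan_basis e k d w) = UNIV \<and>
    (\<forall>i\<in>{1..k}. (e ^^ (d i + 1)) (w i) = 0)"

definition jordan_block :: "('b \<Rightarrow> 'b) \<Rightarrow> (nat \<Rightarrow> nat) \<Rightarrow> (nat \<Rightarrow> 'b) \<Rightarrow> nat \<Rightarrow> 'b set"
  where "jordan_block e d w i = span ((\<lambda>s. (e ^^ s) (w i)) ` {0..d i})"

(* jordan_coeff e k d w i j s phi is the coefficient of phi (w i) at (e ^^ s) (w j). *)
definition jordan_coeff ::
  "('b \<Rightarrow> 'b) \<Rightarrow> nat \<Rightarrow> (nat \<Rightarrow> nat) \<Rightarrow> (nat \<Rightarrow> 'b) \<Rightarrow> nat \<Rightarrow> nat \<Rightarrow> nat \<Rightarrow> ('b \<Rightarrow> 'b) \<Rightarrow> 'a"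
  where "jordan_coeff e k d w i j s \<phi> =
    representation (jordan_basis e k d w) (\<phi> (w i)) ((e ^^ s) (w j))"

(* The description is proper for d j - d i <= s <= d j, see jordan_xi_ex1 below. *)
definition jordan_xi ::
  "('b \<Rightarrow> 'b) \<Rightarrow> nat \<Rightarrow> (nat \<Rightarrow> 'b) \<Rightarrow> nat \<Rightarrow> nat \<Rightarrow> nat \<Rightarrow> 'b \<Rightarrow> 'b"
  where "jordan_xi e k w i j s =
    (THE \<xi>. \<xi> \<in> centraliser e \<and> \<xi> (w i) = (e ^^ s) (w j) \<and> (\<forall>t\<in>{1..k} - {i}. \<xi> (w t) = 0))"

lemma vector_space_op_scale: "vector_space op_scale"
  by unfold_locales
    (auto simp: op_scale_def fun_eq_iff scale_right_distrib scale_left_distrib)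

lemma mem_centraliser_iff:
  "f \<in> centraliser e \<longleftrightarrow> Vector_Spaces.linear scale scale f \<and> (\<forall>v. f (e v) = e (f v))"
proof -
  have "lie_bracket f e = 0 \<longleftrightarrow> f \<circ> e = e \<circ> f"
    unfolding lie_bracket_def by (rule right_minus_eq)
  then show ?thesis
    by (simp add: centraliser_def gl_def fun_eq_iff)
qed

lemma centraliser_funpow:
  assumes "f \<in> centraliser e"
  shows "f ((e ^^ r) v) = (e ^^ r) (f v)"
  using assms by (induction r) (auto simp: mem_centraliser_iff)

lemma lie_bracket_mem_centraliser:
  assumes e: "e \<in> gl" and f: "f \<in> centraliser e" and g: "g \<in> centraliser e"
  shows "lie_bracket f g \<in> centraliser e"
proof -
  interpret vp: vector_space_pair scale scale ..
  have le: "Vector_Spaces.linear scale scale e"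
    using e by (simp add: gl_def)
  have lf: "Vector_Spaces.linear scale scale f" and lg: "Vector_Spaces.linear scale scale g"
    using f g by (simp_all add: mem_centraliser_iff)
  have "Vector_Spaces.linear scale scale (lie_bracket f g)"
    unfolding lie_bracket_def fun_diff_def
    by (intro vp.module_hom_sub Vector_Spaces.linear_compose[OF lf lg] Vector_Spaces.linear_compose[OF lg lf])
  moreover have "lie_bracket f g (e v) = e (lie_bracket f g v)" for v
    using f g by (simp add: mem_centraliser_iff lie_bracket_def vp.linear_diff[OF le])
  ultimately show ?thesis
    by (simp add: mem_centraliser_iff)
qed

lemma jordan_xi_ex1:
  assumes e: "e \<in> gl" and gen: "jordan_generators e k d w"
    and ij: "i \<in> {1..k}" "j \<in> {1..k}" and s: "d j - d i \<le> s" "s \<le> d j"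
  shows "\<exists>!\<xi>. \<xi> \<in> centraliser e \<and> \<xi> (w i) = (e ^^ s) (w j) \<and> (\<forall>t\<in>{1..k} - {i}. \<xi> (w t) = 0)"
proof -
  interpret vp: vector_space_pair scale scale ..
  define B where "B = jordan_basis e k d w"
  define h where "h = (\<lambda>(i, s). (e ^^ s) (w i))"
  define I where "I = jordan_index k d"
  have inj: "inj_on h I" and ind: "independent B" and sp: "span B = UNIV"
    and top: "\<And>t. t \<in> {1..k} \<Longrightarrow> (e ^^ (d t + 1)) (w t) = 0"
    using gen by (auto simp: jordan_generators_def B_def h_def I_def)
  have B: "B = h ` I"
    by (simp add: B_def jordan_basis_def h_def I_def)
  have le: "Vector_Spaces.linear scale scale e"
    using e by (simp add: gl_def)
  have e0: "e 0 = 0"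
    using le by (rule vp.linear_0)
  have pow0: "(e ^^ n) 0 = 0" for n
    by (induction n) (simp_all add: e0)
  define g where "g b = (case inv_into I h b of (t, r) \<Rightarrow> if t = i then (e ^^ (r + s)) (w j) else 0)" for b
  define f where "f = vp.construct B g"
  have lf: "Vector_Spaces.linear scale scale f"
    unfolding f_def by (rule vp.linear_construct[OF ind])
  have fb: "f ((e ^^ r) (w t)) = (if t = i then (e ^^ (r + s)) (w j) else 0)"
    if "t \<in> {1..k}" "r \<le> d t" for t r
  proof -
    have m: "(t, r) \<in> I"
      using that by (simp add: I_def jordan_index_def)
    then have "h (t, r) \<in> B"
      by (simp add: B)
    then have "f (h (t, r)) = g (h (t, r))"
      unfolding f_def by (rule vp.construct_basis[OF ind])
    then show ?thesis
      using m by (auto simp: g_def inv_into_f_f[OF inj]) (auto simp: h_def)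
  qed
  have comm: "(f \<circ> e) v = (e \<circ> f) v" for v
  proof (rule vp.linear_eq_on[where f = "f \<circ> e" and g = "e \<circ> f" and B = B])
    show "Vector_Spaces.linear scale scale (f \<circ> e)" "Vector_Spaces.linear scale scale (e \<circ> f)"
      by (rule Vector_Spaces.linear_compose[OF le lf] Vector_Spaces.linear_compose[OF lf le])+
    show "v \<in> span B"
      by (simp add: sp)
  next
    fix b assume "b \<in> B"
    then obtain t r where tr: "t \<in> {1..k}" "r \<le> d t" and b: "b = (e ^^ r) (w t)"
      by (auto simp: B h_def I_def jordan_index_def)
    show "(f \<circ> e) b = (e \<circ> f) b"
    proof (cases "r = d t")
      case False
      then have "f ((e ^^ Suc r) (w t)) = (if t = i then (e ^^ (Suc r + s)) (w j) else 0)"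
        using tr by (intro fb) auto
      then show ?thesis
        using fb[OF tr] by (simp add: b e0)
    next
      case True
      have "(f \<circ> e) b = f 0"
        using top[OF tr(1)] by (simp add: b True)
      also have "f 0 = 0"
        by (rule vp.linear_0[OF lf])
      finally have l: "(f \<circ> e) b = 0" .
      have "(e ^^ Suc (d i + s)) (w j) = 0"
      proof -
        have "Suc (d i + s) = (d i + s - d j) + (d j + 1)"
          using s by simp
        then have "(e ^^ Suc (d i + s)) (w j) = (e ^^ (d i + s - d j)) ((e ^^ (d j + 1)) (w j))"
          by (simp only: funpow_add o_apply)
        then show ?thesis
          using top[OF ij(2)] by (simp only: pow0)
      qed
      then have "e (f b) = 0"
        using fb[OF tr] by (auto simp: b True e0)
      with l show ?thesis by simp
    qed
  qed
  have fc: "f \<in> centraliser e"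
    using lf comm by (simp add: mem_centraliser_iff)
  show ?thesis
  proof (rule ex1I[of _ f])
    show "f \<in> centraliser e \<and> f (w i) = (e ^^ s) (w j) \<and> (\<forall>t\<in>{1..k} - {i}. f (w t) = 0)"
      using fc fb[of i 0] fb[of _ 0] ij by auto
  next
    fix x assume x: "x \<in> centraliser e \<and> x (w i) = (e ^^ s) (w j) \<and> (\<forall>t\<in>{1..k} - {i}. x (w t) = 0)"
    have lx: "Vector_Spaces.linear scale scale x"
      using x by (simp add: mem_centraliser_iff)
    show "x = f"
    proof
      fix v
      show "x v = f v"
      proof (rule vp.linear_eq_on[OF lx lf, where B = B])
        fix b assume "b \<in> B"
        then obtain t r where tr: "t \<in> {1..k}" "r \<le> d t" and b: "b = (e ^^ r) (w t)"
          by (auto simp: B h_def I_def jordan_index_def)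
        have "x (w t) = f (w t)"
          using x tr fb[of t 0] by (cases "t = i") auto
        then show "x b = f b"
          using x fc by (simp add: b centraliser_funpow)
      qed (simp add: sp)
    qed
  qed
qed

end

end

theory Submission
  imports Defs
begin

text \<open>
  Let \<open>c i j s \<phi>\<close> be the coefficient of \<open>\<phi> (w i)\<close> at \<open>(e ^^ s) (w j)\<close>, read as zero when \<open>s < 0\<close>
  or \<open>s > d j\<close>. Testing \<open>\<alpha> [\<xi>, \<eta>]\<close> on the basis element \<open>\<eta>\<close> of the centraliser that sends
  \<open>w i\<close> to \<open>(e ^^ s) (w j)\<close> and the other generators to zero gives
  \<open>a i * c j i (d i - s) \<xi> - a j * c j i (d j - s) \<xi>\<close> (lemma \<open>commutator_form_xi\<close>).
  So for \<open>\<xi>\<close> in the stabiliser and \<open>i \<noteq> j\<close> the coefficients of \<open>\<xi> (w j)\<close> on block \<open>i\<close> satisfy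
  a two-term recursion whose indices differ by \<open>\<bar>d i - d j\<bar>\<close>. If the blocks have different sizes, the
  recursion expresses each coefficient through one of lower index, because no \<open>a i\<close> vanishes, and
  it starts at zero; if the blocks have the same size, it says that \<open>a i - a j\<close> times the
  coefficient is zero, and \<open>a i \<noteq> a j\<close>. Hence all coefficients between different blocks vanish,
  that is, \<open>\<xi>\<close> preserves every block (lemma \<open>off_diagonal_coord_eq_0\<close>).

  Conversely, if \<open>\<xi>\<close> preserves every block, then only the diagonal coefficients of \<open>\<eta>\<close> enter
  \<open>\<alpha> [\<xi>, \<eta>]\<close>, and on each block these multiply like truncated polynomials in one variable. The
  top coefficients of \<open>\<xi> \<eta>\<close> and \<open>\<eta> \<xi>\<close> are therefore the same convolution and cancel
  (lemma \<open>commutator_form_block_diagonal\<close>).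

  Finally, an element of the centraliser is determined by its values on the generators; comparing
  these values writes a block-preserving \<open>\<xi>\<close> as the combination of the elements
  \<open>jordan_xi e k w i i s\<close> with coefficients \<open>c i i s \<xi>\<close> (lemma \<open>block_preserving_eq_span\<close>).
\<close>

locale jordan_chains = vector_space scale
  for scale :: "'a::field \<Rightarrow> 'b::ab_group_add \<Rightarrow> 'b" (infixr "*s" 75) +
  fixes e :: "'b \<Rightarrow> 'b" and k :: nat and d :: "nat \<Rightarrow> nat" and w :: "nat \<Rightarrow> 'b"
  assumes e_gl: "e \<in> gl"
    and gens: "jordan_generators e k d w"
begin

section \<open>Coordinates in the Jordan basis\<close>

lemma finite_jordan_basis: "finite (jordan_basis e k d w)"
  by (simp add: jordan_basis_def jordan_index_def)

lemma independent_jordan_basis: "independent (jordan_basis e k d w)"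
  and span_jordan_basis: "span (jordan_basis e k d w) = UNIV"
  and inj_on_jordan_index: "inj_on (\<lambda>(i, s). (e ^^ s) (w i)) (jordan_index k d)"
  using gens by (simp_all add: jordan_generators_def)

lemma pow_e_0: "(e ^^ r) 0 = 0"
proof -
  interpret vp: vector_space_pair scale scale ..
  have "e 0 = 0"
    using e_gl by (auto simp: gl_def intro: vp.linear_0)
  then show ?thesis
    by (induction r) simp_all
qed

lemma pow_generator_eq_0:
  assumes "j \<in> {1..k}" "d j < r"
  shows "(e ^^ r) (w j) = 0"
proof -
  have "(e ^^ (d j + 1)) (w j) = 0"
    using gens assms(1) by (auto simp: jordan_generators_def)
  then have "(e ^^ (r - (d j + 1))) ((e ^^ (d j + 1)) (w j)) = 0"
    by (simp only: pow_e_0)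
  moreover have "r = (r - (d j + 1)) + (d j + 1)"
    using assms(2) by simp
  ultimately show ?thesis
    by (metis funpow_add o_apply)
qed

text \<open>Coordinates beyond the end of a chain are zero, so that statements about all coefficients
  on a block can quantify over all indices.\<close>

definition coord :: "nat \<Rightarrow> nat \<Rightarrow> 'b \<Rightarrow> 'a"
  where "coord j s v =
    (if s \<le> d j then representation (jordan_basis e k d w) v ((e ^^ s) (w j)) else 0)"

lemma coord_add: "coord j s (u + v) = coord j s u + coord j s v"
  using independent_jordan_basis by (simp add: coord_def representation_add span_jordan_basis)

lemma coord_scale: "coord j s (c *s v) = c * coord j s v"
  using independent_jordan_basis by (simp add: coord_def representation_scale span_jordan_basis)

lemma coord_diff: "coord j s (u - v) = coord j s u - coord j s v"
  using independent_jordan_basis by (simp add: coord_def representation_diff span_jordan_basis)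

lemma coord_0: "coord j s 0 = 0"
  using coord_scale[of j s 0 0] by simp

lemma coord_sum: "coord j s (sum f A) = (\<Sum>x\<in>A. coord j s (f x))"
  by (induction A rule: infinite_finite_induct) (simp_all add: coord_0 coord_add)

lemma coord_beyond: "d j < s \<Longrightarrow> coord j s v = 0"
  by (simp add: coord_def)

lemma jordan_expansion: "v = (\<Sum>j=1..k. \<Sum>s=0..d j. coord j s v *s (e ^^ s) (w j))"
proof -
  let ?B = "jordan_basis e k d w"
  have "v = (\<Sum>b\<in>?B. representation ?B v b *s b)"
    by (rule sum_representation_eq[symmetric])
      (simp_all add: independent_jordan_basis span_jordan_basis finite_jordan_basis)
  also have "\<dots> = (\<Sum>(j, s)\<in>jordan_index k d.
      representation ?B v ((e ^^ s) (w j)) *s (e ^^ s) (w j))"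
    by (subst (1) jordan_basis_def, subst sum.reindex[OF inj_on_jordan_index])
      (simp add: case_prod_unfold)
  also have "\<dots> = (\<Sum>j=1..k. \<Sum>s=0..d j. representation ?B v ((e ^^ s) (w j)) *s (e ^^ s) (w j))"
    by (simp add: jordan_index_def sum.Sigma)
  also have "\<dots> = (\<Sum>j=1..k. \<Sum>s=0..d j. coord j s v *s (e ^^ s) (w j))"
    by (simp add: coord_def)
  finally show ?thesis .
qed

lemma coord_pow_generator:
  assumes ij: "i \<in> {1..k}" "j \<in> {1..k}"
  shows "coord i t ((e ^^ r) (w j)) = (if i = j \<and> t = r \<and> r \<le> d j then 1 else 0)"
proof (cases "r \<le> d j \<and> t \<le> d i")
  case True
  then have m: "(j, r) \<in> jordan_index k d" "(i, t) \<in> jordan_index k d"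
    using ij by (simp_all add: jordan_index_def)
  then have b: "(e ^^ r) (w j) \<in> jordan_basis e k d w"
    by (force simp: jordan_basis_def)
  have "(e ^^ r) (w j) = (e ^^ t) (w i) \<longleftrightarrow> j = i \<and> r = t"
    using inj_on_eq_iff[OF inj_on_jordan_index m] by simp
  then show ?thesis
    using True representation_basis[OF independent_jordan_basis b] by (auto simp: coord_def)
next
  case False
  then show ?thesis
    using ij by (auto simp: pow_generator_eq_0 coord_0 coord_beyond not_le)
qed

section \<open>Elements of the centraliser in coordinates\<close>

lemma centraliser_linear: "\<phi> \<in> centraliser e \<Longrightarrow> Vector_Spaces.linear scale scale \<phi>"
  by (simp add: mem_centraliser_iff)

lemma pow_e_in_centraliser: "e ^^ r \<in> centraliser e"
proof -
  interpret vp: vector_space_pair scale scale ..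
  have "Vector_Spaces.linear scale scale (e ^^ r)"
  proof (induction r)
    case 0
    then show ?case by (simp add: linear_ident id_def)
  next
    case (Suc r)
    have "Vector_Spaces.linear scale scale e"
      using e_gl by (simp add: gl_def)
    then show ?case
      unfolding funpow.simps by (rule Vector_Spaces.linear_compose[OF Suc])
  qed
  then show ?thesis
    by (simp add: mem_centraliser_iff funpow_swap1)
qed

lemma centraliser_0: "\<phi> \<in> centraliser e \<Longrightarrow> \<phi> 0 = 0"
proof -
  interpret vp: vector_space_pair scale scale ..
  show "\<phi> \<in> centraliser e \<Longrightarrow> \<phi> 0 = 0"
    by (rule vp.linear_0[OF centraliser_linear])
qed

lemma centraliser_expansion:
  assumes "\<phi> \<in> centraliser e"
  shows "\<phi> v = (\<Sum>j=1..k. \<Sum>s=0..d j. coord j s v *s (e ^^ s) (\<phi> (w j)))"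
proof -
  interpret vp: vector_space_pair scale scale ..
  have "\<phi> v = \<phi> (\<Sum>j=1..k. \<Sum>s=0..d j. coord j s v *s (e ^^ s) (w j))"
    by (subst jordan_expansion) (rule refl)
  also have "\<dots> = (\<Sum>j=1..k. \<Sum>s=0..d j. coord j s v *s (e ^^ s) (\<phi> (w j)))"
    by (simp add: vp.linear_sum[OF centraliser_linear[OF assms]]
        vp.linear_scale[OF centraliser_linear[OF assms]] centraliser_funpow[OF assms])
  finally show ?thesis .
qed

lemma centraliser_eqI:
  assumes "\<phi> \<in> centraliser e" "\<psi> \<in> centraliser e" "\<And>j. j \<in> {1..k} \<Longrightarrow> \<phi> (w j) = \<psi> (w j)"
  shows "\<phi> = \<psi>"
proof
  fix v
  show "\<phi> v = \<psi> v"
    unfolding centraliser_expansion[OF assms(1), of v] centraliser_expansion[OF assms(2), of v]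
    by (intro sum.cong refl) (simp add: assms(3))
qed

lemma coord_centraliser:
  assumes "\<phi> \<in> centraliser e"
  shows "coord i t (\<phi> v) = (\<Sum>j=1..k. \<Sum>s=0..d j. coord j s v * coord i t ((e ^^ s) (\<phi> (w j))))"
  by (subst centraliser_expansion[OF assms]) (simp add: coord_sum coord_scale)

lemma coord_pow:
  assumes i: "i \<in> {1..k}"
  shows "coord i t ((e ^^ r) v) = (if r \<le> t \<and> t \<le> d i then coord i (t - r) v else 0)"
proof -
  have "coord i t ((e ^^ r) v) =
      (\<Sum>j=1..k. \<Sum>s=0..d j. coord j s v * coord i t ((e ^^ (s + r)) (w j)))"
    by (subst coord_centraliser[OF pow_e_in_centraliser]) (simp add: funpow_add)
  also have "\<dots> = (\<Sum>j=1..k. if j = i then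
      (\<Sum>s=0..d i. if s = t - r then (if r \<le> t \<and> t \<le> d i then coord i s v else 0) else 0) else 0)"
  proof (intro sum.cong refl)
    fix j assume j: "j \<in> {1..k}"
    have "coord i s v * coord i t ((e ^^ (s + r)) (w i)) =
        (if s = t - r then (if r \<le> t \<and> t \<le> d i then coord i s v else 0) else 0)" for s
      using i by (auto simp: coord_pow_generator)
    moreover have "coord i t ((e ^^ (s + r)) (w j)) = 0" if "j \<noteq> i" for s
      using that by (simp add: coord_pow_generator[OF i j])
    ultimately show "(\<Sum>s=0..d j. coord j s v * coord i t ((e ^^ (s + r)) (w j))) = (if j = i then
        (\<Sum>s=0..d i. if s = t - r then (if r \<le> t \<and> t \<le> d i then coord i s v else 0) else 0) else 0)"
      by (cases "j = i") simp_all
  qed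
  also have "\<dots> = (if r \<le> t \<and> t \<le> d i then coord i (t - r) v else 0)"
    using i by auto
  finally show ?thesis .
qed

text \<open>Since \<open>e\<^bsup>d j + 1\<^esup>\<close> kills \<open>\<phi> (w j)\<close>, the component of \<open>\<phi> (w j)\<close> in a longer block lies in the
  tail of that block. This starts the recursion for the coefficients from a shorter to a longer
  block; from a longer to a shorter one it starts below index zero.\<close>

lemma coord_centraliser_eq_0:
  assumes \<phi>: "\<phi> \<in> centraliser e" and ij: "i \<in> {1..k}" "j \<in> {1..k}" and t: "t + d j < d i"
  shows "coord i t (\<phi> (w j)) = 0"
proof -
  have "(e ^^ (d j + 1)) (\<phi> (w j)) = \<phi> ((e ^^ (d j + 1)) (w j))"
    by (rule centraliser_funpow[OF \<phi>, symmetric])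
  also have "\<dots> = 0"
    using ij pow_generator_eq_0[of j "d j + 1"] centraliser_0[OF \<phi>] by simp
  finally have "coord i (t + (d j + 1)) ((e ^^ (d j + 1)) (\<phi> (w j))) = 0"
    by (simp only: coord_0)
  then show ?thesis
    using t unfolding coord_pow[OF ij(1)] by simp
qed

section \<open>The commutator form\<close>

text \<open>On the centraliser this is the alternating form \<open>(\<xi>, \<eta>) \<mapsto> \<alpha> [\<xi>, \<eta>]\<close>, whose radical is the
  stabiliser of \<open>\<alpha>\<close>.\<close>

definition commutator_form :: "(nat \<Rightarrow> 'a) \<Rightarrow> ('b \<Rightarrow> 'b) \<Rightarrow> ('b \<Rightarrow> 'b) \<Rightarrow> 'a"
  where "commutator_form a \<xi> \<eta> =
    (\<Sum>m=1..k. a m * coord m (d m) (\<xi> (\<eta> (w m)))) - (\<Sum>m=1..k. a m * coord m (d m) (\<eta> (\<xi> (w m))))"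

lemma stabiliser_eq_commutator_form:
  assumes \<alpha>: "\<And>\<phi>. \<phi> \<in> centraliser e \<Longrightarrow>
    \<alpha> \<phi> = (\<Sum>i=1..k. a i * jordan_coeff e k d w i i (d i) \<phi>)"
  shows "stabiliser e \<alpha> =
    {\<xi> \<in> centraliser e. \<forall>\<eta>\<in>centraliser e. commutator_form a \<xi> \<eta> = 0}"
proof -
  have "\<alpha> (lie_bracket \<xi> \<eta>) = commutator_form a \<xi> \<eta>"
    if "\<xi> \<in> centraliser e" "\<eta> \<in> centraliser e" for \<xi> \<eta>
  proof -
    have "\<alpha> (lie_bracket \<xi> \<eta>) = (\<Sum>m=1..k. a m * coord m (d m) (lie_bracket \<xi> \<eta> (w m)))"
      using \<alpha>[OF lie_bracket_mem_centraliser[OF e_gl that]] by (simp add: jordan_coeff_def coord_def)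
    also have "\<dots> = commutator_form a \<xi> \<eta>"
      by (simp add: commutator_form_def lie_bracket_def coord_diff right_diff_distrib sum_subtractf)
    finally show ?thesis .
  qed
  then show ?thesis
    by (auto simp: stabiliser_def)
qed

lemma jordan_xi:
  assumes "i \<in> {1..k}" "j \<in> {1..k}" "d j - d i \<le> s" "s \<le> d j"
  shows jordan_xi_centraliser: "jordan_xi e k w i j s \<in> centraliser e"
    and jordan_xi_generator: "t \<in> {1..k} \<Longrightarrow>
      jordan_xi e k w i j s (w t) = (if t = i then (e ^^ s) (w j) else 0)"
  using theI'[OF jordan_xi_ex1[OF e_gl gens assms], folded jordan_xi_def] by auto

text \<open>In \<open>\<xi> \<eta>\<close> only the generator \<open>w i\<close> contributes, since \<open>\<eta>\<close> kills the others; in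
  \<open>\<eta> \<xi>\<close> only \<open>w j\<close> does, since the image of \<open>\<eta>\<close> lies in block \<open>j\<close>. In both products \<open>\<eta>\<close>
  shifts the index by \<open>s\<close>, but the top of the chain is \<open>d i\<close> in one case and \<open>d j\<close> in the other.\<close>

lemma commutator_form_xi:
  assumes \<xi>: "\<xi> \<in> centraliser e"
    and ij: "i \<in> {1..k}" "j \<in> {1..k}" and s: "d j - d i \<le> s" "s \<le> d j"
  shows "commutator_form a \<xi> (jordan_xi e k w i j s) =
    a i * (if s \<le> d i then coord i (d i - s) (\<xi> (w j)) else 0) - a j * coord i (d j - s) (\<xi> (w j))"
proof -
  let ?\<eta> = "jordan_xi e k w i j s"
  note \<eta> = jordan_xi_centraliser[OF ij s] and \<eta>w = jordan_xi_generator[OF ij s]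
  have "(\<Sum>m=1..k. a m * coord m (d m) (\<xi> (?\<eta> (w m)))) =
      (\<Sum>m=1..k. if m = i then a i * coord i (d i) ((e ^^ s) (\<xi> (w j))) else 0)"
    by (intro sum.cong refl)
      (auto simp: \<eta>w centraliser_0[OF \<xi>] centraliser_funpow[OF \<xi>] coord_0)
  also have "\<dots> = a i * (if s \<le> d i then coord i (d i - s) (\<xi> (w j)) else 0)"
    using ij by (simp add: coord_pow)
  finally have 1: "(\<Sum>m=1..k. a m * coord m (d m) (\<xi> (?\<eta> (w m)))) =
      a i * (if s \<le> d i then coord i (d i - s) (\<xi> (w j)) else 0)" .
  have "coord m (d m) (?\<eta> (\<xi> (w m))) = (if m = j then coord i (d j - s) (\<xi> (w j)) else 0)"
    if m: "m \<in> {1..k}" for m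
  proof -
    have "coord m (d m) (?\<eta> (\<xi> (w m))) = (\<Sum>l=1..k. if l = i then
        (\<Sum>t=0..d i. coord i t (\<xi> (w m)) * coord m (d m) ((e ^^ (t + s)) (w j))) else 0)"
      unfolding coord_centraliser[OF \<eta>]
      by (intro sum.cong refl) (auto simp: \<eta>w pow_e_0 coord_0 funpow_add)
    also have "\<dots> = (\<Sum>t=0..d i. coord i t (\<xi> (w m)) * coord m (d m) ((e ^^ (t + s)) (w j)))"
      using ij by simp
    also have "\<dots> = (\<Sum>t=0..d i. if t = d j - s then (if m = j then coord i t (\<xi> (w j)) else 0) else 0)"
      using ij m s by (intro sum.cong refl) (auto simp: coord_pow_generator)
    \<comment> \<open>The index \<open>d j - s\<close> is in the range of summation because \<open>d j - d i \<le> s\<close>.\<close>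
    also have "\<dots> = (if m = j then coord i (d j - s) (\<xi> (w j)) else 0)"
      using s by auto
    finally show ?thesis .
  qed
  then have "(\<Sum>m=1..k. a m * coord m (d m) (?\<eta> (\<xi> (w m)))) =
      (\<Sum>m=1..k. if m = j then a j * coord i (d j - s) (\<xi> (w j)) else 0)"
    by (intro sum.cong refl) simp
  then show ?thesis
    using 1 ij by (simp add: commutator_form_def)
qed

text \<open>Induction on the index \<open>t\<close> of the coefficient. The test element is always chosen so that its
  equation relates the coefficient of index \<open>t\<close> to the one of index \<open>t - \<bar>d i - d j\<bar>\<close>: the
  coefficient of index \<open>t\<close> belongs to the longer block's term, so its factor is \<open>a i\<close> if
  \<open>d j < d i\<close> and \<open>a j\<close> if \<open>d i < d j\<close>. For blocks of equal size the two terms have the same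
  index and their factors combine to \<open>a i - a j\<close>.\<close>

lemma off_diagonal_coord_eq_0:
  assumes \<xi>: "\<xi> \<in> centraliser e"
    and form: "\<And>\<eta>. \<eta> \<in> centraliser e \<Longrightarrow> commutator_form a \<xi> \<eta> = 0"
    and a: "a i \<noteq> 0" "a j \<noteq> 0" "a i \<noteq> a j"
    and ij: "i \<in> {1..k}" "j \<in> {1..k}"
  shows "coord i t (\<xi> (w j)) = 0"
proof (induction t rule: less_induct)
  case (less t)
  have eq: "a i * (if s \<le> d i then coord i (d i - s) (\<xi> (w j)) else 0) =
      a j * coord i (d j - s) (\<xi> (w j))"
    if s: "d j - d i \<le> s" "s \<le> d j" for s
    using form[OF jordan_xi_centraliser[OF ij s]] commutator_form_xi[OF \<xi> ij s, of a] by simp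
  consider "d i < t" | "t + d j < d i" | "t \<le> d i" "d i \<le> t + d j"
    by linarith
  then show ?case
  proof cases
    case 1
    then show ?thesis by (rule coord_beyond)
  next
    case 2
    then show ?thesis by (rule coord_centraliser_eq_0[OF \<xi> ij])
  next
    case 3
    consider "d j < d i" | "d i < d j" | "d i = d j"
      by linarith
    then show ?thesis
    proof cases
      case 1
      then have "a i * coord i t (\<xi> (w j)) = a j * coord i (d j - (d i - t)) (\<xi> (w j))"
        using eq[of "d i - t"] 3 by simp
      moreover have "coord i (d j - (d i - t)) (\<xi> (w j)) = 0"
        using 1 3 by (intro less) linarith
      ultimately show ?thesis
        using a by simp
    next
      case 2
      then have "a j * coord i t (\<xi> (w j)) =
          a i * (if d j - t \<le> d i then coord i (d i - (d j - t)) (\<xi> (w j)) else 0)"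
        using eq[of "d j - t"] 3 by simp
      moreover have "coord i (d i - (d j - t)) (\<xi> (w j)) = 0" if "d j - t \<le> d i"
        using that 2 3 by (intro less) linarith
      ultimately show ?thesis
        using a by (auto split: if_splits)
    next
      case 3
      then have "a i * coord i t (\<xi> (w j)) = a j * coord i t (\<xi> (w j))"
        using eq[of "d j - t"] \<open>t \<le> d i\<close> by simp
      then show ?thesis
        using a by simp
    qed
  qed
qed

text \<open>The polynomials in \<open>e\<close> by which \<open>\<xi>\<close> and the diagonal part of \<open>\<eta>\<close> act on the generator
  of a block commute; the blocks that \<open>\<eta>\<close> mixes do not contribute because \<open>\<xi>\<close> neither
  leaves nor enters them.\<close>

lemma commutator_form_block_diagonal:
  assumes \<xi>: "\<xi> \<in> centraliser e" and \<eta>: "\<eta> \<in> centraliser e"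
    and diag: "\<And>i j t. i \<in> {1..k} \<Longrightarrow> j \<in> {1..k} \<Longrightarrow> i \<noteq> j \<Longrightarrow> coord i t (\<xi> (w j)) = 0"
  shows "commutator_form a \<xi> \<eta> = 0"
proof -
  have "coord m (d m) (\<xi> (\<eta> (w m))) = coord m (d m) (\<eta> (\<xi> (w m)))" if m: "m \<in> {1..k}" for m
  proof -
    have "coord m (d m) (\<xi> (\<eta> (w m))) = (\<Sum>j=1..k. if j = m then
        (\<Sum>s=0..d m. coord m s (\<eta> (w m)) * coord m (d m - s) (\<xi> (w m))) else 0)"
      unfolding coord_centraliser[OF \<xi>, of m "d m" "\<eta> (w m)"]
      using m by (intro sum.cong refl) (auto simp: coord_pow diag intro!: sum.neutral)
    also have "\<dots> = (\<Sum>s=0..d m. coord m s (\<eta> (w m)) * coord m (d m - s) (\<xi> (w m)))"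
      using m by simp
    also have "\<dots> = (\<Sum>s=0..d m. coord m s (\<xi> (w m)) * coord m (d m - s) (\<eta> (w m)))"
      by (rule sum.reindex_bij_witness[of _ "\<lambda>s. d m - s" "\<lambda>s. d m - s"]) (auto simp: mult.commute)
    also have "\<dots> = (\<Sum>j=1..k. if j = m then
        (\<Sum>s=0..d m. coord m s (\<xi> (w m)) * coord m (d m - s) (\<eta> (w m))) else 0)"
      using m by simp
    also have "\<dots> = coord m (d m) (\<eta> (\<xi> (w m)))"
      unfolding coord_centraliser[OF \<eta>, of m "d m" "\<xi> (w m)"]
      using m by (intro sum.cong refl) (auto simp: coord_pow diag)
    finally show ?thesis .
  qed
  then show ?thesis
    by (simp add: commutator_form_def)
qed

section \<open>Block-preserving elements\<close>

lemma mem_jordan_block_iff: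
  assumes i: "i \<in> {1..k}"
  shows "v \<in> jordan_block e d w i \<longleftrightarrow> (\<forall>j\<in>{1..k}. j \<noteq> i \<longrightarrow> (\<forall>s. coord j s v = 0))"
proof
  assume "v \<in> jordan_block e d w i"
  then show "\<forall>j\<in>{1..k}. j \<noteq> i \<longrightarrow> (\<forall>s. coord j s v = 0)"
    unfolding jordan_block_def
    by (induction rule: span_induct_alt)
      (use i in \<open>auto simp: coord_0 coord_add coord_scale coord_pow_generator\<close>)
next
  assume *: "\<forall>j\<in>{1..k}. j \<noteq> i \<longrightarrow> (\<forall>s. coord j s v = 0)"
  have "v = (\<Sum>j=1..k. \<Sum>s=0..d j. coord j s v *s (e ^^ s) (w j))"
    by (rule jordan_expansion)
  also have "\<dots> = (\<Sum>j=1..k. if j = i then \<Sum>s=0..d i. coord i s v *s (e ^^ s) (w i) else 0)"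
    using * by (intro sum.cong refl) (auto intro!: sum.neutral)
  also have "\<dots> = (\<Sum>s=0..d i. coord i s v *s (e ^^ s) (w i))"
    using i by simp
  also have "\<dots> \<in> jordan_block e d w i"
    unfolding jordan_block_def by (intro span_sum span_scale span_base imageI)
  finally show "v \<in> jordan_block e d w i" .
qed

lemma preserves_block_iff:
  assumes \<phi>: "\<phi> \<in> centraliser e" and i: "i \<in> {1..k}"
  shows "\<phi> ` jordan_block e d w i \<subseteq> jordan_block e d w i \<longleftrightarrow>
    (\<forall>j\<in>{1..k}. j \<noteq> i \<longrightarrow> (\<forall>s. coord j s (\<phi> (w i)) = 0))"
proof
  assume "\<phi> ` jordan_block e d w i \<subseteq> jordan_block e d w i"
  moreover have "w i \<in> jordan_block e d w i"
    unfolding mem_jordan_block_iff[OF i] using coord_pow_generator[OF _ i, of _ _ 0] by simp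
  ultimately show "\<forall>j\<in>{1..k}. j \<noteq> i \<longrightarrow> (\<forall>s. coord j s (\<phi> (w i)) = 0)"
    unfolding mem_jordan_block_iff[OF i, symmetric] by blast
next
  assume *: "\<forall>j\<in>{1..k}. j \<noteq> i \<longrightarrow> (\<forall>s. coord j s (\<phi> (w i)) = 0)"
  show "\<phi> ` jordan_block e d w i \<subseteq> jordan_block e d w i"
  proof (rule image_subsetI)
    fix v assume "v \<in> jordan_block e d w i"
    then have v: "coord j s v = 0" if "j \<in> {1..k}" "j \<noteq> i" for j s
      using that by (simp add: mem_jordan_block_iff[OF i])
    show "\<phi> v \<in> jordan_block e d w i"
      unfolding mem_jordan_block_iff[OF i]
    proof (intro ballI impI allI)
      fix j t assume j: "j \<in> {1..k}" "j \<noteq> i"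
      have "coord l s v * coord j t ((e ^^ s) (\<phi> (w l))) = 0" if "l \<in> {1..k}" for l s
        using that v[of l s] * j by (cases "l = i") (auto simp: coord_pow)
      then show "coord j t (\<phi> v) = 0"
        unfolding coord_centraliser[OF \<phi>] by (simp add: sum.neutral)
    qed
  qed
qed

theorem stabiliser_eq_block_preserving:
  assumes nz: "\<And>i. i \<in> {1..k} \<Longrightarrow> a i \<noteq> 0"
    and neq: "\<And>i j. i \<in> {1..k} \<Longrightarrow> j \<in> {1..k} \<Longrightarrow> i \<noteq> j \<Longrightarrow> a i \<noteq> a j"
    and \<alpha>: "\<And>\<phi>. \<phi> \<in> centraliser e \<Longrightarrow>
      \<alpha> \<phi> = (\<Sum>i=1..k. a i * jordan_coeff e k d w i i (d i) \<phi>)"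
  shows "stabiliser e \<alpha> = {\<phi> \<in> centraliser e.
    \<forall>i\<in>{1..k}. \<phi> ` jordan_block e d w i \<subseteq> jordan_block e d w i}"
proof -
  have "(\<forall>\<eta>\<in>centraliser e. commutator_form a \<xi> \<eta> = 0) \<longleftrightarrow>
      (\<forall>i\<in>{1..k}. \<xi> ` jordan_block e d w i \<subseteq> jordan_block e d w i)"
    if \<xi>: "\<xi> \<in> centraliser e" for \<xi>
  proof
    assume "\<forall>\<eta>\<in>centraliser e. commutator_form a \<xi> \<eta> = 0"
    then show "\<forall>i\<in>{1..k}. \<xi> ` jordan_block e d w i \<subseteq> jordan_block e d w i"
      using off_diagonal_coord_eq_0[OF \<xi>, of a] nz neq by (simp add: preserves_block_iff[OF \<xi>])
  next
    assume "\<forall>i\<in>{1..k}. \<xi> ` jordan_block e d w i \<subseteq> jordan_block e d w i"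
    then have "coord i t (\<xi> (w j)) = 0" if "i \<in> {1..k}" "j \<in> {1..k}" "i \<noteq> j" for i j t
      using that by (simp add: preserves_block_iff[OF \<xi>])
    then show "\<forall>\<eta>\<in>centraliser e. commutator_form a \<xi> \<eta> = 0"
      using commutator_form_block_diagonal[OF \<xi>] by blast
  qed
  moreover have "stabiliser e \<alpha> =
      {\<xi> \<in> centraliser e. \<forall>\<eta>\<in>centraliser e. commutator_form a \<xi> \<eta> = 0}"
    using \<alpha> by (rule stabiliser_eq_commutator_form)
  ultimately show ?thesis
    by (simp cong: conj_cong)
qed

section \<open>Spanning by the diagonal basis elements\<close>

lemma subspace_centraliser: "module.subspace op_scale (centraliser e)"
proof -
  interpret op: vector_space op_scale by (rule vector_space_op_scale)
  interpret vp: vector_space_pair scale scale ..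
  have le: "Vector_Spaces.linear scale scale e"
    using e_gl by (simp add: gl_def)
  show ?thesis
    by (rule op.subspaceI)
      (auto simp: mem_centraliser_iff op_scale_def vp.linear_0[OF le] vp.linear_add[OF le]
        vp.linear_scale[OF le] plus_fun_def zero_fun_def
        intro!: vp.module_hom_zero vp.module_hom_add vp.module_hom_scale)
qed

lemma block_preserving_eq_span:
  "{\<phi> \<in> centraliser e. \<forall>i\<in>{1..k}. \<phi> ` jordan_block e d w i \<subseteq> jordan_block e d w i} =
    op_span {jordan_xi e k w i i s | i s. i \<in> {1..k} \<and> s \<in> {0..d i}}" (is "?P = op_span ?X")
proof
  interpret op: vector_space op_scale by (rule vector_space_op_scale)
  have P: "\<phi> \<in> ?P \<longleftrightarrow> \<phi> \<in> centraliser e \<and>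
      (\<forall>i\<in>{1..k}. \<forall>j\<in>{1..k}. j \<noteq> i \<longrightarrow> (\<forall>s. coord j s (\<phi> (w i)) = 0))" for \<phi>
    using preserves_block_iff[of \<phi>] by blast
  have op_scale_apply: "op_scale c f v = c *s f v" for c f v
    by (simp add: op_scale_def)
  have "op.subspace ?P"
    by (rule op.subspaceI; unfold P)
      (auto simp: op.subspace_0[OF subspace_centraliser] op.subspace_add[OF subspace_centraliser]
        op.subspace_scale[OF subspace_centraliser] op_scale_apply coord_0 coord_add coord_scale)
  moreover have "?X \<subseteq> ?P"
  proof
    fix \<phi> assume "\<phi> \<in> ?X"
    then obtain m r where mr: "m \<in> {1..k}" "r \<le> d m" and \<phi>: "\<phi> = jordan_xi e k w m m r"
      by auto
    show "\<phi> \<in> ?P"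
      using mr unfolding P \<phi>
      by (auto simp: jordan_xi_centraliser jordan_xi_generator coord_pow_generator coord_0)
  qed
  ultimately show "op_span ?X \<subseteq> ?P"
    unfolding op_span_def by (intro op.span_minimal)
  show "?P \<subseteq> op_span ?X"
  proof
    fix \<phi> assume "\<phi> \<in> ?P"
    then have \<phi>: "\<phi> \<in> centraliser e"
      and diag: "\<And>i j s. i \<in> {1..k} \<Longrightarrow> j \<in> {1..k} \<Longrightarrow> j \<noteq> i \<Longrightarrow> coord j s (\<phi> (w i)) = 0"
      unfolding P by blast+
    define \<psi> where "\<psi> = (\<Sum>i=1..k. \<Sum>s=0..d i. op_scale (coord i s (\<phi> (w i))) (jordan_xi e k w i i s))"
    have "\<phi> = \<psi>"
    proof (rule centraliser_eqI[OF \<phi>])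
      show "\<psi> \<in> centraliser e"
        unfolding \<psi>_def
        by (intro op.subspace_sum op.subspace_scale subspace_centraliser jordan_xi_centraliser) auto
      fix j assume j: "j \<in> {1..k}"
      have sum_apply: "(\<Sum>x\<in>A. f x) v = (\<Sum>x\<in>A. f x v)" for A :: "nat set" and f :: "nat \<Rightarrow> 'b \<Rightarrow> 'b" and v
        by (induction A rule: infinite_finite_induct) simp_all
      have "\<psi> (w j) = (\<Sum>i=1..k. \<Sum>s=0..d i. coord i s (\<phi> (w i)) *s jordan_xi e k w i i s (w j))"
        by (simp add: \<psi>_def sum_apply op_scale_def)
      also have "\<dots> = (\<Sum>i=1..k. \<Sum>s=0..d i. coord i s (\<phi> (w j)) *s (e ^^ s) (w i))"
        using j by (intro sum.cong refl) (auto simp: jordan_xi_generator diag)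
      also have "\<dots> = \<phi> (w j)"
        by (rule jordan_expansion[symmetric])
      finally show "\<phi> (w j) = \<psi> (w j)" ..
    qed
    also have "\<psi> \<in> op_span ?X"
      unfolding \<psi>_def op_span_def by (intro op.span_sum op.span_scale op.span_base) auto
    finally show "\<phi> \<in> op_span ?X" .
  qed
qed

end

theorem theorem1:
  fixes scale :: "'k::field \<Rightarrow> 'v::ab_group_add \<Rightarrow> 'v"
    and B :: "'v set"
    and e :: "'v \<Rightarrow> 'v"
    and k :: nat
    and d :: "nat \<Rightarrow> nat"
    and w :: "nat \<Rightarrow> 'v"
    and a :: "nat \<Rightarrow> 'k"
    and \<alpha> :: "('v \<Rightarrow> 'v) \<Rightarrow> 'k"
  assumes "finite_dimensional_vector_space scale B"
    and "e \<in> vector_space.gl scale"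
    and "vector_space.nilpotent e"
    and "vector_space.jordan_generators scale e k d w"
    and "\<And>i. i \<in> {1..k} \<Longrightarrow> a i \<noteq> 0"
    and "\<And>i j. i \<in> {1..k} \<Longrightarrow> j \<in> {1..k} \<Longrightarrow> i \<noteq> j \<Longrightarrow> a i \<noteq> a j"
    and "\<And>\<phi>. \<phi> \<in> vector_space.centraliser scale e \<Longrightarrow>
           \<alpha> \<phi> = (\<Sum>i = 1..k. a i * vector_space.jordan_coeff scale e k d w i i (d i) \<phi>)"
  shows "vector_space.stabiliser scale e \<alpha> =
           {\<phi> \<in> vector_space.centraliser scale e. \<forall>i\<in>{1..k}.
              \<phi> ` vector_space.jordan_block scale e d w i
                \<subseteq> vector_space.jordan_block scale e d w i}
         \<and> vector_space.stabiliser scale e \<alpha> =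
           vector_space.op_span scale
             {vector_space.jordan_xi scale e k w i i s | i s. i \<in> {1..k} \<and> s \<in> {0..d i}}"
proof -
  interpret finite_dimensional_vector_space scale B
    by (rule assms(1))
  interpret jordan_chains scale e k d w
    by unfold_locales (use assms(2,4) in auto)
  show ?thesis
    using stabiliser_eq_block_preserving[of a \<alpha>, OF assms(5-7)] block_preserving_eq_span by simp
qed

end
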